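(* For each $n\in\{10,12,14\}$ there exists an edge-critical uniquely $3$-colorable planar graph with exactly $n$ vertices and exactly $\frac{5}{2}n-7$ edges.
   Context: All graphs are finite, undirected and simple. A graph $G$ is uniquely $k$-colorable if its chromatic number is $k$ and $G$ has only one $k$-coloring (proper coloring of the vertices with $k$ colors) up to permutation of the colors. A uniquely $k$-colorable graph $G$ is edge-critical if $G-e$ is not uniquely $k$-colorable for any edge $e\in E(G)$. *)

theory Defs
  imports "HOL-Analysis.Analysis" "HOL-Combinatorics.Permutations"
begin

text \<open>A graph is given by its vertex set \<open>V\<close> and its set \<open>E\<close> of edges, which are two-element
  sets of vertices.\<close>

definition simple_graph :: "'a set \<Rightarrow> 'a set set \<Rightarrow> bool" where
  "simple_graph V E \<longleftrightarrow> finite V \<and> (\<forall>e\<in>E. e \<subseteq> V \<and> card e = 2)"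

definition proper_coloring :: "nat \<Rightarrow> 'a set \<Rightarrow> 'a set set \<Rightarrow> ('a \<Rightarrow> nat) \<Rightarrow> bool" where
  "proper_coloring k V E c \<longleftrightarrow>
     (\<forall>v\<in>V. c v < k) \<and> (\<forall>u\<in>V. \<forall>v\<in>V. {u, v} \<in> E \<longrightarrow> c u \<noteq> c v)"

definition chromatic_number :: "'a set \<Rightarrow> 'a set set \<Rightarrow> nat" where
  "chromatic_number V E = (LEAST k. \<exists>c. proper_coloring k V E c)"

text \<open>Colorings are total functions, so they are compared on \<open>V\<close> only.\<close>

definition uniquely_colorable :: "nat \<Rightarrow> 'a set \<Rightarrow> 'a set set \<Rightarrow> bool" where
  "uniquely_colorable k V E \<longleftrightarrow>
     chromatic_number V E = k \<and>
     (\<forall>c d. proper_coloring k V E c \<and> proper_coloring k V E d \<longrightarrow>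
        (\<exists>\<pi>. \<pi> permutes {..<k} \<and> (\<forall>v\<in>V. d v = \<pi> (c v))))"

definition edge_critical_uniquely_colorable :: "nat \<Rightarrow> 'a set \<Rightarrow> 'a set set \<Rightarrow> bool" where
  "edge_critical_uniquely_colorable k V E \<longleftrightarrow>
     uniquely_colorable k V E \<and> (\<forall>e\<in>E. \<not> uniquely_colorable k V (E - {e}))"

text \<open>Planarity is the existence of a drawing in the Euclidean plane: \<open>p\<close> places the vertices and
  \<open>\<gamma> e\<close> is a simple arc joining the ends of \<open>e\<close>, which meets vertices and other edges only in
  common ends.\<close>

definition plane_drawing ::
  "'a set \<Rightarrow> 'a set set \<Rightarrow> ('a \<Rightarrow> real \<times> real) \<Rightarrow> ('a set \<Rightarrow> real \<Rightarrow> real \<times> real) \<Rightarrow> bool" where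
  "plane_drawing V E p \<gamma> \<longleftrightarrow>
     inj_on p V \<and>
     (\<forall>e\<in>E. arc (\<gamma> e) \<and> {pathstart (\<gamma> e), pathfinish (\<gamma> e)} = p ` e \<and>
             path_image (\<gamma> e) \<inter> p ` V = p ` e) \<and>
     (\<forall>e\<in>E. \<forall>f\<in>E. e \<noteq> f \<longrightarrow> path_image (\<gamma> e) \<inter> path_image (\<gamma> f) = p ` (e \<inter> f))"

definition planar :: "'a set \<Rightarrow> 'a set set \<Rightarrow> bool" where
  "planar V E \<longleftrightarrow> (\<exists>p \<gamma>. plane_drawing V E p \<gamma>)"

end

(* Three explicit graphs, found by computer search, with straight-line drawings on integer points.
   Their 3-colorings are enumerated to get uniqueness.  Every edge {u, v} has a coloring in which it
   is the only monochromatic edge: after deleting {u, v} this coloring and the unique one of the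
   whole graph are both proper, and no permutation of the colors relates them, since only one of
   them separates u from v. *)

theory Submission
  imports Defs
begin

section \<open>Straight-line drawings\<close>

text \<open>Twice the signed area of the triangle \<open>a b c\<close>: its sign tells on which side
  of the line through \<open>a\<close> and \<open>b\<close> the point \<open>c\<close> lies. The
  ring is left general so that the same formula is used over the reals and evaluated on integer
  coordinates.\<close>

definition orient :: "'a::comm_ring_1 \<times> 'a \<Rightarrow> 'a \<times> 'a \<Rightarrow> 'a \<times> 'a \<Rightarrow> 'a" where
  "orient a b c = (fst b - fst a) * (snd c - snd a) - (snd b - snd a) * (fst c - fst a)"

lemma orient_segment_start:
  fixes a b z :: "real \<times> real"
  assumes "z \<in> closed_segment a b"
  shows "orient a b z = 0"
proof -
  obtain t where z: "z = (1 - t) *\<^sub>R a + t *\<^sub>R b"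
    using assms by (auto simp: in_segment)
  show ?thesis by (simp add: z orient_def algebra_simps)
qed

text \<open>\<open>orient a b\<close> is an affine function of its third argument, so along a
  segment its values are the convex combinations of the two end values.\<close>

lemma orient_combination:
  fixes a b c d :: "real \<times> real"
  shows "orient a b ((1 - t) *\<^sub>R c + t *\<^sub>R d) = (1 - t) * orient a b c + t * orient a b d"
  by (simp add: orient_def algebra_simps)

text \<open>The hypothesis puts \<open>c\<close> and \<open>d\<close> strictly on the same side of
  the line through \<open>a\<close> and \<open>b\<close>. An open half-plane is convex, so it
  contains the whole segment from \<open>c\<close> to \<open>d\<close>, while the other segment
  stays on the line.\<close>

lemma segments_disjoint:
  fixes a b c d :: "real \<times> real"
  assumes "orient a b c * orient a b d > 0"
  shows "closed_segment a b \<inter> closed_segment c d = {}"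
proof -
  have "orient a b z \<noteq> 0" if "z \<in> closed_segment c d" for z
  proof -
    obtain t where t: "0 \<le> t" "t \<le> 1" and z: "z = (1 - t) *\<^sub>R c + t *\<^sub>R d"
      using \<open>z \<in> closed_segment c d\<close> by (auto simp: in_segment)
    consider "orient a b c > 0" "orient a b d > 0" | "orient a b c < 0" "orient a b d < 0"
      using assms by (auto simp: zero_less_mult_iff)
    then show ?thesis
    proof cases
      case 1
      then have "orient a b z > 0"
        \<comment> \<open>\<open>convex_bound_lt\<close> bounds a convex combination from above, so
          the positive case goes through the negated values.\<close>
        using convex_bound_lt[of "- orient a b c" 0 "- orient a b d" "1 - t" t] t
        by (simp add: z orient_combination)
      then show ?thesis by simp
    next
      case 2
      then have "orient a b z < 0"
        using convex_bound_lt[of "orient a b c" 0 "orient a b d" "1 - t" t] t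
        by (simp add: z orient_combination)
      then show ?thesis by simp
    qed
  qed
  then show ?thesis using orient_segment_start by blast
qed

text \<open>At parameter \<open>t\<close> on the segment from \<open>a\<close> to \<open>d\<close>
  the orientation is \<open>t * orient a b d\<close>, which vanishes only at \<open>t = 0\<close>,
  that is, at \<open>a\<close>.\<close>

lemma segments_common_end:
  fixes a b d :: "real \<times> real"
  assumes "orient a b d \<noteq> 0"
  shows "closed_segment a b \<inter> closed_segment a d = {a}"
proof -
  have "z = a" if zb: "z \<in> closed_segment a b" and zd: "z \<in> closed_segment a d" for z
  proof -
    obtain t where z: "z = (1 - t) *\<^sub>R a + t *\<^sub>R d"
      using zd by (auto simp: in_segment)
    have "orient a b a = 0" by (simp add: orient_def)
    then have "t * orient a b d = 0"
      using orient_segment_start[OF zb] by (simp add: z orient_combination)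
    then show ?thesis using assms z by simp
  qed
  then show ?thesis by auto
qed

text \<open>Edges with a common end must not be collinear; for edges without one, some edge lies
  strictly on one side of the line through the other. The alternative \<open>b = d\<close> in the
  first branch lets an edge pass the comparison with itself.\<close>

fun noncrossing :: "(int \<times> int) list \<Rightarrow> nat \<times> nat \<Rightarrow> nat \<times> nat \<Rightarrow> bool" where
  "noncrossing P (a, b) (c, d) \<longleftrightarrow>
     (if a = c then b = d \<or> orient (P ! a) (P ! b) (P ! d) \<noteq> 0
      else if a = d then orient (P ! a) (P ! b) (P ! c) \<noteq> 0
      else if b = c then orient (P ! b) (P ! a) (P ! d) \<noteq> 0
      else if b = d then orient (P ! b) (P ! a) (P ! c) \<noteq> 0
      else orient (P ! a) (P ! b) (P ! c) * orient (P ! a) (P ! b) (P ! d) > 0 \<or>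
           orient (P ! c) (P ! d) (P ! a) * orient (P ! c) (P ! d) (P ! b) > 0)"

definition point :: "(int \<times> int) list \<Rightarrow> nat \<Rightarrow> real \<times> real" where
  "point P v = (of_int (fst (P ! v)), of_int (snd (P ! v)))"

lemma orient_point:
  "orient (point P a) (point P b) (point P c) = of_int (orient (P ! a) (P ! b) (P ! c))"
  by (simp add: orient_def point_def)

section \<open>Graphs given by lists of increasing pairs\<close>

definition edges :: "(nat \<times> nat) list \<Rightarrow> nat set set" where
  "edges es = (\<lambda>(u, v). {u, v}) ` set es"

text \<open>Increasing pairs exclude loops and give each edge a single representative, so that the
  length of a distinct list counts edges. They also ensure that the smaller end is colored first
  when vertices are colored in increasing order.\<close>

definition wf_edges :: "nat \<Rightarrow> (nat \<times> nat) list \<Rightarrow> bool" where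
  "wf_edges n es \<longleftrightarrow> distinct es \<and> list_all (\<lambda>(u, v). u < v \<and> v < n) es"

lemma wf_edgesD: "wf_edges n es \<Longrightarrow> (u, v) \<in> set es \<Longrightarrow> u < v \<and> v < n"
  by (auto simp: wf_edges_def list_all_iff)

lemma simple_graph_edges: "wf_edges n es \<Longrightarrow> simple_graph {..<n} (edges es)"
  by (fastforce simp: simple_graph_def edges_def dest: wf_edgesD)

lemma inj_edges:
  assumes "wf_edges n es"
  shows "inj_on (\<lambda>(u, v). {u, v}) (set es)"
proof -
  have "(v, u) \<notin> set es" if "(u, v) \<in> set es" for u v
    using wf_edgesD[OF assms] that less_asym by blast
  then show ?thesis by (auto simp: inj_on_def doubleton_eq_iff)
qed

lemma card_edges: "wf_edges n es \<Longrightarrow> card (edges es) = length es"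
  unfolding edges_def using card_image[OF inj_edges] by (simp add: distinct_card wf_edges_def)

section \<open>Planarity from integer coordinates\<close>

lemma noncrossing_Int:
  assumes "noncrossing P (a, b) (c, d)" "(a, b) \<noteq> (c, d)" "a < b" "c < d"
  shows "closed_segment (point P a) (point P b) \<inter> closed_segment (point P c) (point P d)
    = point P ` ({a, b} \<inter> {c, d})"
proof -
  let ?p = "point P"
  \<comment> \<open>Because \<open>a < b\<close> and \<open>c < d\<close>, two different pairs share
    at most one end; hence these cases exclude each other and match the branches of
    \<open>noncrossing\<close>.\<close>
  consider (1) "a = c" "b \<noteq> d" | (2) "a = d" | (3) "b = c" | (4) "b = d" "a \<noteq> c"
    | (5) "a \<noteq> c" "a \<noteq> d" "b \<noteq> c" "b \<noteq> d"
    using assms(2) by blast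
  then show ?thesis
  proof cases
    case 1
    then have "orient (?p a) (?p b) (?p d) \<noteq> 0" using assms by (simp add: orient_point)
    from segments_common_end[OF this] show ?thesis using 1 assms by auto
  next
    case 2
    then have "orient (?p a) (?p b) (?p c) \<noteq> 0" using assms by (simp add: orient_point)
    from segments_common_end[OF this] show ?thesis
      using 2 assms by (auto simp: closed_segment_commute)
  next
    case 3
    then have "orient (?p b) (?p a) (?p d) \<noteq> 0" using assms by (simp add: orient_point)
    from segments_common_end[OF this] show ?thesis
      using 3 assms by (auto simp: closed_segment_commute)
  next
    case 4
    then have "orient (?p b) (?p a) (?p c) \<noteq> 0" using assms by (simp add: orient_point)
    from segments_common_end[OF this] show ?thesis
      using 4 assms by (auto simp: closed_segment_commute)
  next
    case 5
    then have "orient (?p a) (?p b) (?p c) * orient (?p a) (?p b) (?p d) > 0 \<or>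
        orient (?p c) (?p d) (?p a) * orient (?p c) (?p d) (?p b) > 0"
      using assms(1) by (simp add: orient_point flip: of_int_mult)
    then have "closed_segment (?p a) (?p b) \<inter> closed_segment (?p c) (?p d) = {}"
      using segments_disjoint by blast
    then show ?thesis using 5 by auto
  qed
qed

text \<open>Since every vertex lies on an edge, no edge passes through a foreign vertex as soon as
  the edges do not cross each other.\<close>

definition straight_drawing :: "nat \<Rightarrow> (nat \<times> nat) list \<Rightarrow> (int \<times> int) list \<Rightarrow> bool" where
  "straight_drawing n es P \<longleftrightarrow>
     length P = n \<and> distinct P \<and>
     list_all (\<lambda>e. list_all (noncrossing P e) es) es \<and>
     list_all (\<lambda>v. list_ex (\<lambda>(a, b). a = v \<or> b = v) es) [0..<n]"

lemma planar_edges: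
  assumes wf: "wf_edges n es" and draw: "straight_drawing n es P"
  shows "planar {..<n} (edges es)"
proof -
  let ?p = "point P"
  \<comment> \<open>Arcs are indexed by edges as unordered sets; \<open>Min\<close> and
    \<open>Max\<close> recover the pair in the list.\<close>
  define \<gamma> where "\<gamma> e = linepath (?p (Min e)) (?p (Max e))" for e
  have \<gamma>: "\<gamma> {a, b} = linepath (?p a) (?p b)" if "(a, b) \<in> set es" for a b
    using wf_edgesD[OF wf that] by (simp add: \<gamma>_def)
  have inj: "inj_on ?p {..<n}"
    using draw
    by (auto simp: inj_on_def straight_drawing_def point_def prod_eq_iff
        simp flip: nth_eq_iff_index_eq)
  have cross: "path_image (\<gamma> {a, b}) \<inter> path_image (\<gamma> {c, d}) = ?p ` ({a, b} \<inter> {c, d})"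
    if ab: "(a, b) \<in> set es" and cd: "(c, d) \<in> set es" and ne: "(a, b) \<noteq> (c, d)" for a b c d
  proof -
    have "noncrossing P (a, b) (c, d)"
      using draw ab cd unfolding straight_drawing_def list_all_iff by blast
    then show ?thesis
      using noncrossing_Int[OF _ ne] wf_edgesD[OF wf ab] wf_edgesD[OF wf cd] \<gamma>[OF ab] \<gamma>[OF cd]
      by simp
  qed
  have cover: "\<exists>c d. (c, d) \<in> set es \<and> v \<in> {c, d}" if "v < n" for v
  proof -
    have "list_ex (\<lambda>(a, b). a = v \<or> b = v) es"
      using draw that by (simp add: straight_drawing_def list_all_iff)
    then show ?thesis by (auto simp: list_ex_iff)
  qed
  have vert: "path_image (\<gamma> {a, b}) \<inter> ?p ` {..<n} = ?p ` {a, b}" if ab: "(a, b) \<in> set es" for a b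
  proof -
    have lt: "a < b" "b < n" using wf_edgesD[OF wf ab] by auto
    have "v \<in> {a, b}" if v: "v < n" "?p v \<in> path_image (\<gamma> {a, b})" for v
    \<comment> \<open>A foreign vertex \<open>v\<close> is an end of another edge
      \<open>{c, d}\<close>, so its point lies on both arcs. By \<open>cross\<close> it is the point
      of a common end, which contradicts the injectivity of the placement.\<close>
    proof (rule ccontr)
      assume nv: "v \<notin> {a, b}"
      obtain c d where cd: "(c, d) \<in> set es" and vcd: "v \<in> {c, d}"
        using cover v(1) by blast
      have "(a, b) \<noteq> (c, d)" using nv vcd by auto
      moreover have "?p v \<in> path_image (\<gamma> {c, d})"
        using vcd by (auto simp: \<gamma>[OF cd])
      ultimately have "?p v \<in> ?p ` ({a, b} \<inter> {c, d})"
        using cross[OF ab cd] v(2) by blast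
      then obtain w where "w \<in> {a, b}" "?p v = ?p w" by blast
      then show False using inj nv lt v(1) by (auto simp: inj_on_def)
    qed
    moreover have "?p a \<in> path_image (\<gamma> {a, b})" "?p b \<in> path_image (\<gamma> {a, b})"
      by (auto simp: \<gamma>[OF ab])
    ultimately show ?thesis using lt by fastforce
  qed
  have arc: "arc (\<gamma> {a, b})" if ab: "(a, b) \<in> set es" for a b
  proof -
    have "?p a \<noteq> ?p b"
      using wf_edgesD[OF wf ab] inj by (auto simp: inj_on_def)
    then show ?thesis by (simp add: \<gamma>[OF ab])
  qed
  have "plane_drawing {..<n} (edges es) ?p \<gamma>"
    unfolding plane_drawing_def
  proof (intro conjI ballI impI)
    show "inj_on ?p {..<n}" by (fact inj)
  next
    fix e assume "e \<in> edges es"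
    then obtain a b where ab: "(a, b) \<in> set es" and e: "e = {a, b}"
      by (auto simp: edges_def)
    show "arc (\<gamma> e)" using arc[OF ab] e by simp
    show "{pathstart (\<gamma> e), pathfinish (\<gamma> e)} = ?p ` e" by (simp add: e \<gamma>[OF ab])
    show "path_image (\<gamma> e) \<inter> ?p ` {..<n} = ?p ` e" using vert[OF ab] e by simp
  next
    fix e f assume "e \<in> edges es" "f \<in> edges es" "e \<noteq> f"
    then obtain a b c d where ab: "(a, b) \<in> set es" and e: "e = {a, b}"
      and cd: "(c, d) \<in> set es" and f: "f = {c, d}"
      by (auto simp: edges_def)
    then show "path_image (\<gamma> e) \<inter> path_image (\<gamma> f) = ?p ` (e \<inter> f)"
      using cross[OF ab cd] \<open>e \<noteq> f\<close> by blast
  qed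
  then show ?thesis unfolding planar_def by blast
qed

section \<open>Enumerating colorings\<close>

text \<open>Backtracking search in which position \<open>v\<close> of a list holds the color of
  vertex \<open>v\<close>. When vertex \<open>m\<close> is added, only edges with larger end
  \<open>m\<close> are tested; for increasing pairs the other end already has its color in
  \<open>cs\<close>.\<close>

fun colorings :: "nat \<Rightarrow> (nat \<times> nat) list \<Rightarrow> nat \<Rightarrow> nat list list" where
  "colorings k es 0 = [[]]"
| "colorings k es (Suc m) =
     concat (map (\<lambda>cs. map (\<lambda>x. cs @ [x])
       (filter (\<lambda>x. list_all (\<lambda>(u, v). v = m \<longrightarrow> cs ! u \<noteq> x) es) [0..<k])) (colorings k es m))"

lemma proper_coloring_edges:
  assumes "wf_edges n es"
  shows "proper_coloring k {..<n} (edges es) c \<longleftrightarrow>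
    (\<forall>v<n. c v < k) \<and> (\<forall>(u, v)\<in>set es. c u \<noteq> c v)"
proof
  assume L: "proper_coloring k {..<n} (edges es) c"
  have "c u \<noteq> c v" if "(u, v) \<in> set es" for u v
  proof -
    have "{u, v} \<in> edges es" using that by (auto simp: edges_def)
    then show ?thesis using L wf_edgesD[OF assms that] by (simp add: proper_coloring_def)
  qed
  then show "(\<forall>v<n. c v < k) \<and> (\<forall>(u, v)\<in>set es. c u \<noteq> c v)"
    using L by (auto simp: proper_coloring_def)
next
  assume R: "(\<forall>v<n. c v < k) \<and> (\<forall>(u, v)\<in>set es. c u \<noteq> c v)"
  have "c u \<noteq> c v" if uv: "{u, v} \<in> edges es" for u v
  proof -
    obtain a b where "(a, b) \<in> set es" "{u, v} = {a, b}" using uv by (auto simp: edges_def)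
    then show ?thesis using R by (auto simp: doubleton_eq_iff)
  qed
  then show "proper_coloring k {..<n} (edges es) c"
    using R by (simp add: proper_coloring_def)
qed

text \<open>Completeness of the search: the prefixes of a proper coloring pass every test. So a
  property checked on the finite list holds for all proper colorings, and an empty list shows that
  there are none.\<close>

lemma map_in_colorings:
  assumes wf: "wf_edges n es" and c: "proper_coloring k {..<n} (edges es) c"
  shows "m \<le> n \<Longrightarrow> map c [0..<m] \<in> set (colorings k es m)"
proof (induction m)
  case (Suc m)
  have "map c [0..<m] ! u \<noteq> c m" if "(u, m) \<in> set es" for u
    using that c wf_edgesD[OF wf that] by (auto simp: proper_coloring_edges[OF wf])
  moreover have "c m < k"
    using c Suc.prems by (auto simp: proper_coloring_edges[OF wf])
  ultimately show ?case using Suc by (auto simp: list_all_iff)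
qed simp

section \<open>Chromatic number and unique 3-colorability\<close>

lemma proper_coloring_mono:
  "proper_coloring k V E c \<Longrightarrow> k \<le> l \<Longrightarrow> proper_coloring l V E c"
  unfolding proper_coloring_def by fastforce

text \<open>A coloring with fewer than \<open>k\<close> colors is also one with \<open>k\<close>
  colors, so excluding exactly \<open>k\<close> colors is enough for minimality.\<close>

lemma chromatic_number_Suc:
  assumes "proper_coloring (Suc k) V E c" and "\<And>d. \<not> proper_coloring k V E d"
  shows "chromatic_number V E = Suc k"
  unfolding chromatic_number_def
proof (rule Least_equality)
  show "\<exists>c. proper_coloring (Suc k) V E c" using assms(1) by blast
next
  fix l assume "\<exists>c. proper_coloring l V E c"
  then show "Suc k \<le> l"
    using assms(2) proper_coloring_mono by (metis not_less_eq_eq)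
qed

text \<open>The list \<open>q\<close> is a permutation of the colors in one-line notation. Since
  \<open>permutes\<close> demands the identity outside \<open>{..<k}\<close>, list access is
  extended by a conditional.\<close>

lemma nth_permutes:
  assumes "distinct q" "set q = {..<k}"
  shows "(\<lambda>x. if x < k then q ! x else x) permutes {..<k}"
proof (rule bij_imp_permutes)
  have "length q = k" using assms distinct_card by fastforce
  then have "bij_betw ((!) q) {..<k} {..<k}"
    using assms by (intro bij_betw_nth) simp_all
  moreover have "bij_betw (\<lambda>x. if x < k then q ! x else x) {..<k} {..<k} \<longleftrightarrow>
      bij_betw ((!) q) {..<k} {..<k}"
    by (rule bij_betw_cong) simp
  ultimately show "bij_betw (\<lambda>x. if x < k then q ! x else x) {..<k} {..<k}" by simp
qed auto

definition perms3 :: "nat list list" where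
  "perms3 = [[0, 1, 2], [0, 2, 1], [1, 0, 2], [1, 2, 0], [2, 0, 1], [2, 1, 0]]"

definition unique3 :: "nat \<Rightarrow> (nat \<times> nat) list \<Rightarrow> nat list \<Rightarrow> bool" where
  "unique3 n es c0 \<longleftrightarrow>
     length c0 = n \<and> list_all (\<lambda>x. x < 3) c0 \<and> list_all (\<lambda>(u, v). c0 ! u \<noteq> c0 ! v) es \<and>
     colorings 2 es n = [] \<and>
     list_all (\<lambda>cs. list_ex (\<lambda>q. cs = map ((!) q) c0) perms3) (colorings 3 es n)"

text \<open>The permutations of the colors form a group, so colorings that all arise from one
  reference coloring \<open>c0\<close> by permuting colors arise from each other in the same way.
  The empty search with two colors gives the lower bound on the chromatic number.\<close>

lemma uniquely_3_colorable_edges: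
  assumes wf: "wf_edges n es" and u: "unique3 n es c0"
  shows "uniquely_colorable 3 {..<n} (edges es)"
proof -
  have c0: "proper_coloring 3 {..<n} (edges es) ((!) c0)"
    using u by (auto simp: proper_coloring_edges[OF wf] unique3_def list_all_iff)
  have "\<not> proper_coloring 2 {..<n} (edges es) d" for d
    using map_in_colorings[OF wf, of 2 d n] u by (auto simp: unique3_def)
  then have chi: "chromatic_number {..<n} (edges es) = 3"
    using chromatic_number_Suc[of 2 _ _ "(!) c0"] c0 by simp
  have perm: "\<exists>\<pi>. \<pi> permutes {..<3} \<and> (\<forall>v<n. c v = \<pi> (c0 ! v))"
    if c: "proper_coloring 3 {..<n} (edges es) c" for c
  proof -
    have "map c [0..<n] \<in> set (colorings 3 es n)" using map_in_colorings[OF wf c] by simp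
    then obtain q where q: "q \<in> set perms3" and eq: "map c [0..<n] = map ((!) q) c0"
      using u unfolding unique3_def list_all_iff list_ex_iff by blast
    have "distinct q \<and> set q = {..<3}" using q by (auto simp: perms3_def)
    then have "(\<lambda>x. if x < 3 then q ! x else x) permutes {..<3}" using nth_permutes by blast
    moreover have "c v = q ! (c0 ! v) \<and> c0 ! v < 3" if "v < n" for v
      using arg_cong[OF eq, of "\<lambda>xs. xs ! v"] that u by (simp add: unique3_def list_all_length)
    \<comment> \<open>The colors in \<open>c0\<close> are below 3, so on them the conditional
      returns \<open>q ! x\<close>.\<close>
    ultimately show ?thesis by (intro exI[of _ "\<lambda>x. if x < 3 then q ! x else x"]) simp
  qed
  have "\<exists>\<pi>. \<pi> permutes {..<3} \<and> (\<forall>v\<in>{..<n}. d v = \<pi> (c v))"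
    if c: "proper_coloring 3 {..<n} (edges es) c" and d: "proper_coloring 3 {..<n} (edges es) d"
    for c d
  proof -
    obtain \<pi> where \<pi>: "\<pi> permutes {..<3}" "\<forall>v<n. c v = \<pi> (c0 ! v)" using perm[OF c] by blast
    obtain \<rho> where \<rho>: "\<rho> permutes {..<3}" "\<forall>v<n. d v = \<rho> (c0 ! v)" using perm[OF d] by blast
    \<comment> \<open>Passing from \<open>c\<close> back to \<open>c0\<close> by
      \<open>inv \<pi>\<close> and on to \<open>d\<close> by \<open>\<rho>\<close> relates the two
      colorings.\<close>
    have "\<rho> \<circ> inv \<pi> permutes {..<3}" using \<pi>(1) \<rho>(1) permutes_compose permutes_inv by blast
    moreover have "\<forall>v\<in>{..<n}. d v = (\<rho> \<circ> inv \<pi>) (c v)"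
      using \<pi> \<rho> by (simp add: permutes_inverses(2))
    ultimately show ?thesis by blast
  qed
  then show ?thesis using chi by (simp add: uniquely_colorable_def)
qed

section \<open>Edge-criticality\<close>

lemma not_uniquely_colorable:
  assumes "proper_coloring k V E c" "proper_coloring k V E d"
    and "u \<in> V" "v \<in> V" "c u = c v" "d u \<noteq> d v"
  shows "\<not> uniquely_colorable k V E"
proof
  assume "uniquely_colorable k V E"
  then have "\<exists>\<pi>. \<pi> permutes {..<k} \<and> (\<forall>w\<in>V. d w = \<pi> (c w))"
    using assms(1,2) by (simp add: uniquely_colorable_def)
  then obtain \<pi> where "\<forall>w\<in>V. d w = \<pi> (c w)" by blast
  \<comment> \<open>Equal colors under \<open>c\<close> stay equal after applying
    \<open>\<pi>\<close>, which would force \<open>d u = d v\<close>.\<close>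
  then show False using assms(3-6) by simp
qed

text \<open>The table lists every edge together with a coloring in which it is the only monochromatic
  edge.\<close>

definition critical_table :: "nat \<Rightarrow> ((nat \<times> nat) \<times> nat list) list \<Rightarrow> bool" where
  "critical_table n tab \<longleftrightarrow>
     list_all (\<lambda>(e, c). length c = n \<and> list_all (\<lambda>x. x < 3) c \<and>
       list_all (\<lambda>((u, v), _). (c ! u = c ! v) = ((u, v) = e)) tab) tab"

lemma edge_critical_edges:
  assumes wf: "wf_edges n (map fst tab)" and u: "unique3 n (map fst tab) c0"
    and tab: "critical_table n tab"
  shows "edge_critical_uniquely_colorable 3 {..<n} (edges (map fst tab))"
proof -
  let ?E = "edges (map fst tab)"
  have "\<not> uniquely_colorable 3 {..<n} (?E - {e})" if eE: "e \<in> ?E" for e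
  proof -
    obtain a b c where mem: "((a, b), c) \<in> set tab" and e: "e = {a, b}"
      using eE by (auto simp: edges_def)
    have ab_mem: "(a, b) \<in> set (map fst tab)" using mem by force
    have ab: "a < b" "b < n" using wf_edgesD[OF wf ab_mem] by auto
    have all: "length c = n \<and> (\<forall>x\<in>set c. x < 3) \<and>
        (\<forall>((u, v), _)\<in>set tab. (c ! u = c ! v) = ((u, v) = (a, b)))"
      using bspec[OF tab[unfolded critical_table_def list_all_iff] mem] unfolding prod.case .
    then have len: "\<forall>v<n. c ! v < 3" by (metis nth_mem)
    have mono: "(c ! u = c ! v) = ((u, v) = (a, b))" if "((u, v), d) \<in> set tab" for u v d
      using bspec[OF all[THEN conjunct2, THEN conjunct2] that] by (simp only: prod.case)
    have "c ! x \<noteq> c ! y" if xyE: "{x, y} \<in> ?E - {e}" for x y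
    proof -
      obtain u v d where uv: "((u, v), d) \<in> set tab" and xy: "{x, y} = {u, v}"
        using xyE unfolding edges_def by fastforce
      \<comment> \<open>The deleted edge is the only one that \<open>c\<close> leaves monochromatic,
        so \<open>c\<close> is proper on what remains.\<close>
      have "(u, v) \<noteq> (a, b)" using xyE xy e by blast
      then have "c ! u \<noteq> c ! v" using mono[OF uv] by blast
      then show ?thesis using xy by (auto simp: doubleton_eq_iff)
    qed
    then have c: "proper_coloring 3 {..<n} (?E - {e}) ((!) c)"
      using len by (simp add: proper_coloring_def)
    have c0: "proper_coloring 3 {..<n} ?E ((!) c0)"
      using u by (auto simp: proper_coloring_edges[OF wf] unique3_def list_all_iff)
    then have c0': "proper_coloring 3 {..<n} (?E - {e}) ((!) c0)"
      by (simp add: proper_coloring_def)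
    have "c0 ! a \<noteq> c0 ! b"
      using c0 ab_mem by (auto simp: proper_coloring_edges[OF wf])
    moreover have "c ! a = c ! b" using mono[OF mem] by blast
    ultimately show ?thesis using not_uniquely_colorable[OF c c0', of a b] ab by simp
  qed
  then show ?thesis
    using uniquely_3_colorable_edges[OF wf u] unfolding edge_critical_uniquely_colorable_def
    by blast
qed

text \<open>All conjuncts are executable tests on finite lists of numbers, so a concrete instance is
  settled by evaluation.\<close>

definition certificate ::
  "nat \<Rightarrow> ((nat \<times> nat) \<times> nat list) list \<Rightarrow> nat list \<Rightarrow> (int \<times> int) list \<Rightarrow> bool" where
  "certificate n tab c0 P \<longleftrightarrow>
     wf_edges n (map fst tab) \<and> unique3 n (map fst tab) c0 \<and> critical_table n tab \<and>
     straight_drawing n (map fst tab) P"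

lemma certificateD:
  assumes "certificate n tab c0 P"
  shows "simple_graph {..<n} (edges (map fst tab))" "planar {..<n} (edges (map fst tab))"
    "edge_critical_uniquely_colorable 3 {..<n} (edges (map fst tab))"
    "card (edges (map fst tab)) = length tab"
proof -
  have wf: "wf_edges n (map fst tab)" and u: "unique3 n (map fst tab) c0"
    and crit: "critical_table n tab" and draw: "straight_drawing n (map fst tab) P"
    using assms unfolding certificate_def by blast+
  show "simple_graph {..<n} (edges (map fst tab))" using simple_graph_edges[OF wf] .
  show "planar {..<n} (edges (map fst tab))" using planar_edges[OF wf draw] .
  show "edge_critical_uniquely_colorable 3 {..<n} (edges (map fst tab))"
    using edge_critical_edges[OF wf u crit] .
  show "card (edges (map fst tab)) = length tab" using card_edges[OF wf] by simp
qed

section \<open>The three graphs\<close>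

definition table10 :: "((nat \<times> nat) \<times> nat list) list" where
  "table10 =
    [((0, 1), [0, 0, 1, 2, 2, 1, 2, 0, 0, 2]), ((0, 2), [0, 1, 0, 1, 1, 2, 1, 0, 2, 0]),
     ((1, 2), [0, 1, 1, 2, 2, 1, 0, 1, 2, 0]), ((0, 3), [0, 1, 2, 0, 1, 2, 0, 2, 1, 0]),
     ((2, 3), [0, 1, 2, 2, 2, 1, 0, 1, 1, 0]), ((0, 4), [0, 1, 2, 1, 0, 1, 0, 2, 1, 0]),
     ((0, 5), [0, 1, 2, 1, 1, 0, 1, 0, 0, 2]), ((4, 5), [0, 1, 2, 1, 1, 1, 0, 2, 1, 0]),
     ((2, 6), [0, 1, 2, 1, 2, 1, 2, 0, 0, 2]), ((5, 6), [0, 1, 2, 1, 2, 1, 1, 0, 0, 2]),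
     ((3, 7), [0, 1, 2, 1, 2, 1, 0, 1, 1, 0]), ((4, 7), [0, 1, 2, 1, 2, 1, 0, 2, 1, 0]),
     ((6, 7), [0, 1, 2, 1, 1, 2, 0, 0, 1, 0]), ((2, 8), [0, 1, 2, 1, 1, 2, 0, 2, 2, 0]),
     ((6, 8), [0, 1, 2, 1, 1, 2, 1, 0, 1, 0]), ((1, 9), [0, 1, 2, 1, 1, 2, 1, 0, 0, 1]),
     ((5, 9), [0, 1, 2, 1, 1, 2, 0, 2, 1, 2]), ((8, 9), [0, 1, 2, 1, 1, 2, 1, 0, 0, 0])]"

text \<open>As in the two later certificates, the vertices 0, 1, 2 form a triangle, which excludes
  two colors, and the reference coloring gives them the colors 0, 1, 2. The last list holds the
  coordinates of the vertices in increasing order.\<close>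

lemma certificate10:
  "certificate 10 table10 [0, 1, 2, 1, 1, 2, 0, 2, 1, 0]
     [(5, 3), (6, 2), (7, 5), (8, 7), (3, 6), (1, 8), (9, 8),
      (5, 5), (6, 0), (3, 2)]"
  by code_simp

definition table12 :: "((nat \<times> nat) \<times> nat list) list" where
  "table12 =
    [((0, 1), [0, 0, 1, 2, 1, 0, 2, 2, 2, 0, 1, 1]), ((0, 2), [0, 1, 0, 2, 0, 1, 2, 2, 2, 1, 0, 0]),
     ((1, 2), [0, 1, 1, 0, 0, 2, 1, 1, 2, 0, 1, 2]), ((1, 3), [0, 1, 2, 1, 0, 1, 2, 2, 2, 1, 0, 0]),
     ((2, 3), [0, 1, 2, 2, 0, 1, 2, 2, 2, 0, 1, 1]), ((1, 4), [0, 1, 2, 0, 1, 0, 2, 2, 0, 1, 2, 0]),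
     ((2, 5), [0, 1, 2, 0, 0, 2, 1, 1, 2, 0, 1, 2]), ((4, 5), [0, 1, 2, 0, 0, 0, 1, 1, 2, 0, 1, 2]),
     ((0, 6), [0, 1, 2, 0, 2, 1, 0, 0, 0, 1, 2, 2]), ((4, 6), [0, 1, 2, 0, 2, 1, 2, 0, 0, 1, 2, 2]),
     ((5, 6), [0, 1, 2, 0, 0, 1, 1, 2, 2, 0, 1, 1]), ((4, 7), [0, 1, 2, 0, 2, 0, 1, 2, 0, 1, 2, 0]),
     ((5, 7), [0, 1, 2, 0, 0, 1, 2, 1, 2, 0, 1, 2]), ((1, 8), [0, 1, 2, 0, 0, 1, 2, 2, 1, 0, 2, 1]),
     ((4, 8), [0, 1, 2, 0, 0, 1, 2, 2, 0, 1, 2, 0]), ((2, 9), [0, 1, 2, 0, 2, 0, 1, 1, 0, 2, 1, 0]),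
     ((7, 9), [0, 1, 2, 0, 2, 0, 1, 1, 0, 1, 2, 0]), ((8, 9), [0, 1, 2, 0, 2, 0, 1, 1, 0, 0, 1, 2]),
     ((3, 10), [0, 1, 2, 0, 0, 1, 2, 2, 2, 1, 0, 0]), ((8, 10), [0, 1, 2, 0, 0, 1, 2, 2, 2, 0, 2, 1]),
     ((9, 10), [0, 1, 2, 0, 0, 1, 2, 2, 2, 1, 1, 0]), ((7, 11), [0, 1, 2, 0, 0, 1, 2, 2, 2, 0, 1, 2]),
     ((9, 11), [0, 1, 2, 0, 0, 1, 2, 2, 2, 0, 1, 0])]"

lemma certificate12:
  "certificate 12 table12 [0, 1, 2, 0, 0, 1, 2, 2, 2, 0, 1, 1]
     [(4, 3), (9, 1), (2, 3), (1, 0), (10, 5), (6, 5), (9, 2),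
      (6, 6), (11, 7), (7, 8), (1, 11), (5, 5)]"
  by code_simp

definition table14 :: "((nat \<times> nat) \<times> nat list) list" where
  "table14 =
    [((0, 1), [0, 0, 1, 2, 0, 1, 2, 0, 0, 0, 1, 2, 1, 0]), ((0, 2), [0, 1, 0, 2, 1, 0, 1, 2, 2, 1, 0, 1, 2, 0]),
     ((1, 2), [0, 1, 1, 0, 2, 0, 1, 2, 2, 2, 1, 0, 2, 1]), ((1, 3), [0, 1, 2, 1, 0, 1, 2, 0, 0, 0, 2, 1, 0, 2]),
     ((2, 3), [0, 1, 2, 2, 0, 1, 2, 0, 0, 0, 1, 2, 0, 1]), ((2, 4), [0, 1, 2, 0, 2, 1, 2, 0, 0, 2, 1, 2, 0, 1]),
     ((3, 4), [0, 1, 2, 0, 0, 1, 2, 0, 0, 2, 1, 2, 0, 1]), ((4, 5), [0, 1, 2, 0, 1, 1, 2, 0, 0, 2, 1, 2, 0, 1]),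
     ((0, 6), [0, 1, 2, 0, 1, 2, 0, 1, 1, 1, 2, 0, 2, 1]), ((5, 6), [0, 1, 2, 0, 1, 2, 2, 0, 0, 1, 2, 1, 0, 2]),
     ((2, 7), [0, 1, 2, 0, 1, 0, 1, 2, 2, 2, 1, 0, 2, 1]), ((5, 7), [0, 1, 2, 0, 1, 0, 1, 0, 2, 2, 1, 0, 2, 1]),
     ((6, 7), [0, 1, 2, 0, 1, 0, 1, 1, 2, 2, 1, 0, 2, 1]), ((5, 8), [0, 1, 2, 0, 1, 0, 2, 1, 0, 1, 2, 1, 0, 2]),
     ((6, 8), [0, 1, 2, 0, 1, 2, 1, 0, 1, 1, 2, 0, 2, 1]), ((3, 9), [0, 1, 2, 0, 1, 2, 1, 0, 0, 0, 1, 2, 0, 1]),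
     ((5, 9), [0, 1, 2, 0, 1, 2, 1, 0, 0, 2, 1, 2, 0, 1]), ((3, 10), [0, 1, 2, 0, 1, 0, 2, 1, 1, 1, 0, 2, 0, 1]),
     ((8, 10), [0, 1, 2, 0, 1, 0, 2, 1, 1, 2, 1, 2, 0, 1]), ((9, 10), [0, 1, 2, 0, 1, 2, 1, 0, 0, 1, 1, 2, 0, 1]),
     ((8, 11), [0, 1, 2, 0, 1, 0, 2, 1, 1, 1, 2, 1, 0, 2]), ((10, 11), [0, 1, 2, 0, 1, 0, 2, 1, 1, 1, 2, 2, 0, 1]),
     ((1, 12), [0, 1, 2, 0, 1, 0, 2, 1, 1, 1, 2, 0, 1, 2]), ((6, 12), [0, 1, 2, 0, 1, 0, 2, 1, 1, 1, 2, 0, 2, 1]),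
     ((11, 12), [0, 1, 2, 0, 1, 0, 2, 1, 1, 1, 2, 0, 0, 1]), ((3, 13), [0, 1, 2, 0, 1, 2, 1, 0, 0, 1, 2, 1, 2, 0]),
     ((11, 13), [0, 1, 2, 0, 1, 2, 1, 0, 0, 1, 2, 1, 0, 1]), ((12, 13), [0, 1, 2, 0, 1, 2, 1, 0, 0, 1, 2, 1, 2, 2])]"

lemma certificate14:
  "certificate 14 table14 [0, 1, 2, 0, 1, 2, 1, 0, 0, 1, 2, 1, 0, 2]
     [(11, 9), (9, 11), (13, 12), (5, 11), (1, 12), (3, 0), (6, 1),
      (7, 1), (6, 2), (2, 9), (3, 2), (4, 4), (10, 9), (5, 7)]"
  by code_simp

theorem mainTheorem2:
  fixes n :: nat
  assumes "n \<in> {10, 12, 14}"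
  shows "\<exists>(V :: nat set) E. simple_graph V E \<and> planar V E \<and>
           edge_critical_uniquely_colorable 3 V E \<and>
           card V = n \<and> real (card E) = 5 / 2 * real n - 7"
proof -
  \<comment> \<open>These lengths are the values of \<open>5 / 2 * n - 7\<close> at 10, 12 and
    14.\<close>
  have "length table10 = 18" "length table12 = 23" "length table14 = 28"
    by (simp_all add: table10_def table12_def table14_def)
  then obtain tab c0 P where cert: "certificate n tab c0 P"
    and len: "real (length tab) = 5 / 2 * real n - 7"
    using assms certificate10 certificate12 certificate14 that by auto
  show ?thesis
    by (intro exI[of _ "{..<n}"] exI[of _ "edges (map fst tab)"] conjI certificateD[OF cert])
      (simp_all add: certificateD(4)[OF cert] len)
qed

end
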